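(* For every positive integer $t$, there exists an integer $N$ such that if $G$ is a graph and the complete graph $K_{t+1}$ is not a minor of $G$, then $V(G)$ can be partitioned into $3t$ sets $X_1,X_2,\ldots,X_{3t}$ such that for each $1\le i\le 3t$, every connected component of the induced subgraph $G[X_i]$ has at most $N$ vertices.
   Context: All graphs are finite and simple. A graph $H$ is a minor of $G$ if a graph isomorphic to $H$ can be obtained from a subgraph of $G$ by contracting edges. $G[X]$ denotes the subgraph of $G$ induced on $X$. *)

theory Defs
  imports "Graph_Theory.Graph_Theory" "HOL-Library.Disjoint_Sets"
begin

text \<open>
  A finite simple graph is a \<^locale>\<open>pair_graph\<close>: a finite vertex set together with
  a symmetric irreflexive set of arcs, the undirected edge between \<open>u\<close> and \<open>v\<close> being the two arcs
  \<open>(u, v)\<close> and \<open>(v, u)\<close>.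
\<close>

text \<open>
  Contraction of the edge between \<open>u\<close> and \<open>v\<close>. The vertex that results from identifying the two ends is
  named \<open>u\<close>. The loop that arises from the contracted edge is deleted; parallel edges
  are merged because the arcs form a set.
\<close>

definition contract_edge :: "'a pair_pre_digraph \<Rightarrow> 'a \<Rightarrow> 'a \<Rightarrow> 'a pair_pre_digraph" where
  "contract_edge G u v =
    \<lparr> pverts = pverts G - {v},
      parcs = map_prod (id(v := u)) (id(v := u)) ` parcs G - Id \<rparr>"

lemma pair_graph_contract_edge:
  assumes "pair_graph G" and uv: "(u, v) \<in> parcs G"
  shows "pair_graph (contract_edge G u v)"
proof -
  interpret pair_graph G by fact
  let ?f = "id(v := u)"
  have ne: "u \<noteq> v" and u: "u \<in> pverts G"
    using uv no_loops' in_arcsD1 by auto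
  have f: "?f x \<in> pverts G - {v}" if "x \<in> pverts G" for x
    using that u ne by auto
  have sym: "(y, x) \<in> parcs G" if "(x, y) \<in> parcs G" for x y
    using that pair_sym_arcs by (auto simp: symmetric_def dest: symD)
  show ?thesis
  proof
    fix e assume "e \<in> parcs (contract_edge G u v)"
    then obtain x y where "(x, y) \<in> parcs G" "e = (?f x, ?f y)" "?f x \<noteq> ?f y"
      unfolding contract_edge_def by fastforce
    then show "fst e \<in> pverts (contract_edge G u v)"
      and "snd e \<in> pverts (contract_edge G u v)" and "fst e \<noteq> snd e"
      using f in_arcsD1 in_arcsD2 by (simp_all add: contract_edge_def)
  next
    show "finite (pverts (contract_edge G u v))" "finite (parcs (contract_edge G u v))"
      using pair_finite_verts pair_finite_arcs by (simp_all add: contract_edge_def)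
  next
    have "sym (parcs (contract_edge G u v))"
    proof (rule symI)
      fix a b assume "(a, b) \<in> parcs (contract_edge G u v)"
      then obtain x y where xy: "(x, y) \<in> parcs G" "a = ?f x" "b = ?f y" "a \<noteq> b"
        unfolding contract_edge_def by fastforce
      then have "(b, a) = map_prod ?f ?f (y, x)" by simp
      then have "(b, a) \<in> map_prod ?f ?f ` parcs G" using sym[OF xy(1)] by blast
      then show "(b, a) \<in> parcs (contract_edge G u v)"
        using xy(4) by (simp add: contract_edge_def)
    qed
    then show "symmetric (with_proj (contract_edge G u v))" by (simp add: symmetric_def)
  qed
qed

definition edge_contraction :: "'a pair_pre_digraph \<Rightarrow> 'a pair_pre_digraph \<Rightarrow> bool" where
  "edge_contraction G G' \<longleftrightarrow> (\<exists>(u, v) \<in> parcs G. G' = contract_edge G u v)"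

text \<open>
  The condition \<open>pair_graph S\<close> is needed because \<^const>\<open>subgraph\<close> alone
  would allow \<open>S\<close> to contain only one of the two arcs of an edge.
\<close>

definition is_minor :: "'b pair_pre_digraph \<Rightarrow> 'a pair_pre_digraph \<Rightarrow> bool" where
  "is_minor H G \<longleftrightarrow>
    (\<exists>S G'. pair_graph S \<and> subgraph (with_proj S) (with_proj G) \<and>
      edge_contraction\<^sup>*\<^sup>* S G' \<and> digraph_iso (with_proj G') (with_proj H))"

text \<open>
  The connected components of a graph are its maximal connected subgraphs; the empty graph
  is not \<^const>\<open>connected\<close>.
\<close>

definition connected_component_of_graph ::
    "('a, 'b) pre_digraph \<Rightarrow> ('a, 'b) pre_digraph \<Rightarrow> bool" where
  "connected_component_of_graph C G \<longleftrightarrow> pre_digraph.max_subgraph G connected C"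

end

theory Submission
  imports Defs
begin

text \<open>
  The argument is the chordal partition method of van den Heuvel and Wood, and it needs only
  \<open>2 * t\<close> colours and \<open>N = t\<close>. Peel off connected parts one at a time so that the earlier parts
  touching any component \<open>C\<close> of what remains are pairwise adjacent. Together with \<open>C\<close> they form a
  complete minor, so there are fewer than \<open>t\<close> of them and one of \<open>t\<close> part colours is free. The
  next part is a union of at most \<open>t\<close> geodesics of \<open>C\<close> from a common root, one to a neighbour of
  each of these earlier parts. It has at most \<open>t\<close> vertices at each distance from the root, so
  the parity of the distance splits it into two classes whose components have at most \<open>t\<close>
  vertices.
\<close>

section \<open>Connected vertex sets\<close>

text \<open>The empty set counts as connected, so fibres of labels that do not occur need no
  exception; nonemptiness of branch sets is demanded separately.\<close>

definition conn :: "'a rel \<Rightarrow> 'a set \<Rightarrow> bool" where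
  "conn E S \<longleftrightarrow> (\<forall>u \<in> S. \<forall>v \<in> S. (u, v) \<in> (Restr E S)\<^sup>*)"

definition adj :: "'a rel \<Rightarrow> 'a set \<Rightarrow> 'a set \<Rightarrow> bool" where
  "adj E A B \<longleftrightarrow> (\<exists>a \<in> A. \<exists>b \<in> B. (a, b) \<in> E)"

lemma connD: "conn E S \<Longrightarrow> u \<in> S \<Longrightarrow> v \<in> S \<Longrightarrow> (u, v) \<in> (Restr E S)\<^sup>*"
  by (simp add: conn_def)

lemma adj_sym: "sym E \<Longrightarrow> adj E A B \<longleftrightarrow> adj E B A"
  by (auto simp: adj_def dest: symD)

lemma adj_mono: "adj E A B \<Longrightarrow> A \<subseteq> A' \<Longrightarrow> B \<subseteq> B' \<Longrightarrow> adj E A' B'"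
  by (auto simp: adj_def)

lemma Restr_rtrancl_mono:
  assumes "(u, v) \<in> (Restr E S)\<^sup>*" "E \<subseteq> F" "S \<subseteq> T"
  shows "(u, v) \<in> (Restr F T)\<^sup>*"
proof -
  have "Restr E S \<subseteq> Restr F T" using assms by blast
  then show ?thesis using assms(1) rtrancl_mono by blast
qed

lemma sym_Restr_rtrancl:
  assumes "sym E" "(u, v) \<in> (Restr E S)\<^sup>*" shows "(v, u) \<in> (Restr E S)\<^sup>*"
proof -
  have "sym (Restr E S)" using assms(1) by (auto simp: sym_def)
  then show ?thesis using assms(2) sym_rtrancl symD by metis
qed

lemma connI_root:
  assumes "sym E" "\<And>v. v \<in> S \<Longrightarrow> (r, v) \<in> (Restr E S)\<^sup>*"
  shows "conn E S"
  unfolding conn_def using assms sym_Restr_rtrancl rtrancl_trans by metis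

lemma conn_Union_common:
  assumes "sym E" "\<And>A. A \<in> F \<Longrightarrow> conn E A" "\<And>A. A \<in> F \<Longrightarrow> r \<in> A"
  shows "conn E (\<Union>F)"
proof (rule connI_root[OF assms(1), of _ r])
  fix v assume "v \<in> \<Union>F"
  then obtain A where "A \<in> F" "v \<in> A" by blast
  then show "(r, v) \<in> (Restr E (\<Union>F))\<^sup>*"
    using Restr_rtrancl_mono[OF connD[OF assms(2) assms(3)], of A v E "\<Union>F"] by blast
qed

lemma conn_insert:
  assumes "sym E" "conn E A" "u \<in> A" "(u, v) \<in> E"
  shows "conn E (insert v A)"
proof (rule connI_root[OF assms(1), of _ u])
  fix w assume w: "w \<in> insert v A"
  show "(u, w) \<in> (Restr E (insert v A))\<^sup>*"
  proof (cases "w \<in> A")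
    case True
    then show ?thesis
      using Restr_rtrancl_mono[OF connD[OF assms(2,3)], of w E "insert v A"] by blast
  next
    case False
    then have "(u, w) \<in> Restr E (insert v A)" using w assms by auto
    then show ?thesis by blast
  qed
qed

lemma conn_Un_adj:
  assumes "sym E" "conn E A" "conn E B" "adj E A B"
  shows "conn E (A \<union> B)"
proof -
  obtain a b where ab: "a \<in> A" "b \<in> B" "(a, b) \<in> E" using assms(4) by (auto simp: adj_def)
  \<comment> \<open>Adding the end \<open>a\<close> of a joining edge to \<open>B\<close> makes the
    two connected sets share \<open>a\<close>.\<close>
  have "conn E (\<Union>{insert a B, A})"
    using ab assms conn_insert[OF assms(1,3) ab(2), of a]
    by (intro conn_Union_common[of _ _ a]) (auto dest: symD)
  moreover have "\<Union>{insert a B, A} = A \<union> B" using ab by blast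
  ultimately show ?thesis by simp
qed

text \<open>A walk inside \<open>S\<close> from \<open>x\<close> to \<open>y\<close> starts in
  \<open>A\<close> and ends outside it, so one of its arcs leaves \<open>A\<close>.\<close>

lemma conn_exit:
  assumes "conn E S" "x \<in> S" "x \<in> A" "y \<in> S" "y \<notin> A"
  obtains u v where "u \<in> S" "u \<in> A" "v \<in> S" "v \<notin> A" "(u, v) \<in> E"
proof -
  have "(x, y) \<in> (Restr E S)\<^sup>*" using assms by (simp add: conn_def)
  then have "y \<in> A \<or> (\<exists>u v. u \<in> S \<and> u \<in> A \<and> v \<in> S \<and> v \<notin> A \<and> (u, v) \<in> E)"
    by induction (use assms(3) in auto)
  then show ?thesis using that assms(5) by blast
qed

text \<open>\<open>C\<close> is the component of \<open>r\<close> in the graph induced on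
  \<open>W\<close>. For maximality, walks inside \<open>D\<close> stay in \<open>W\<close>, so they
  extend a walk from \<open>r\<close> to a common vertex of \<open>D\<close> and
  \<open>C\<close>.\<close>

lemma conn_component:
  assumes "sym E" and "r \<in> W"
  defines "C \<equiv> {v. (r, v) \<in> (Restr E W)\<^sup>*}"
  shows "r \<in> C" "C \<subseteq> W" "conn E C" "\<And>D. conn E D \<Longrightarrow> D \<subseteq> W \<Longrightarrow> D \<inter> C \<noteq> {} \<Longrightarrow> D \<subseteq> C"
proof -
  show "r \<in> C" by (simp add: C_def)
  show "C \<subseteq> W"
  proof
    fix v assume "v \<in> C"
    then have "(r, v) \<in> (Restr E W)\<^sup>*" by (simp add: C_def)
    then show "v \<in> W" by induction (use assms in auto)
  qed
  show "conn E C"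
  proof (rule connI_root[OF assms(1), of _ r])
    fix v assume "v \<in> C"
    then have "(r, v) \<in> (Restr E W)\<^sup>*" by (simp add: C_def)
    then show "(r, v) \<in> (Restr E C)\<^sup>*"
    proof induction
      case (step y z)
      then have "z \<in> C" "y \<in> C"
        using C_def by (auto intro: rtrancl_into_rtrancl)
      then show ?case using step by (meson IntD1 IntI SigmaI rtrancl.rtrancl_into_rtrancl)
    qed simp
  qed
  show "D \<subseteq> C" if D: "conn E D" "D \<subseteq> W" "D \<inter> C \<noteq> {}" for D
  proof
    fix v assume "v \<in> D"
    obtain x where x: "x \<in> D" "(r, x) \<in> (Restr E W)\<^sup>*" using D(3) by (auto simp: C_def)
    have "(x, v) \<in> (Restr E W)\<^sup>*"
      using Restr_rtrancl_mono[OF connD[OF D(1) x(1) \<open>v \<in> D\<close>]] D(2) by blast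
    then show "v \<in> C" using x by (auto simp: C_def)
  qed
qed

section \<open>Unions of geodesics\<close>

text \<open>Let \<open>d\<close> be the distance in \<open>C\<close> from a fixed root. A geodesic
  from the root has at most one vertex at each distance, so one geodesic per element of
  \<open>T\<close> gives at most \<open>card T\<close> vertices per level, and the common root
  connects their union.\<close>

lemma geodesic_union:
  assumes "sym E" "conn E C" "finite C" "T \<subseteq> C" "T \<noteq> {}"
  shows "\<exists>H (d :: 'a \<Rightarrow> nat). T \<subseteq> H \<and> H \<subseteq> C \<and> conn E H \<and>
    (\<forall>x y. (x, y) \<in> Restr E C \<longrightarrow> d y \<le> Suc (d x)) \<and>
    (\<forall>m. card {x \<in> H. d x = m} \<le> card T)"
proof -
  let ?R = "Restr E C"
  obtain r where r: "r \<in> C" using assms by blast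
  define d where "d v = (LEAST n. (r, v) \<in> ?R ^^ n)" for v
  have d: "(r, v) \<in> ?R ^^ d v" if "v \<in> C" for v
    unfolding d_def by (rule LeastI_ex) (use connD[OF assms(2) r that] rtrancl_imp_relpow in blast)
  have d_le: "d v \<le> n" if "(r, v) \<in> ?R ^^ n" for n v
    using that unfolding d_def by (rule Least_le)
  have step: "d y \<le> Suc (d x)" if "(x, y) \<in> ?R" for x y
  proof -
    have "x \<in> C" using that by blast
    from relpow_Suc_I[OF d[OF this] that] show ?thesis by (rule d_le)
  qed
  \<comment> \<open>\<open>P\<close> is the vertex set of a geodesic from \<open>r\<close> to
    \<open>v\<close>. The bound \<open>n\<close> on distances keeps \<open>d\<close> injective when
    the next vertex, at distance \<open>Suc n\<close>, is added.\<close>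
  have "\<exists>P. r \<in> P \<and> v \<in> P \<and> P \<subseteq> C \<and> conn E P \<and> inj_on d P \<and> (\<forall>x \<in> P. d x \<le> n)"
    if "v \<in> C" "d v = n" for v n
    using that
  proof (induction n arbitrary: v)
    case 0
    then have "v = r" using d[of v] by simp
    then show ?case using r 0 by (intro exI[of _ "{r}"]) (auto simp: conn_def)
  next
    case (Suc n)
    then have "(r, v) \<in> ?R ^^ Suc n" using d by metis
    then obtain u where u: "(r, u) \<in> ?R ^^ n" "(u, v) \<in> ?R" by auto
    have "d u = n" using d_le[OF u(1)] step[OF u(2)] Suc.prems by simp
    with Suc.IH[of u] u obtain P where P: "r \<in> P" "u \<in> P" "P \<subseteq> C" "conn E P" "inj_on d P"
      "\<forall>x \<in> P. d x \<le> n" by blast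
    then show ?case
      using Suc.prems u conn_insert[OF assms(1) P(4,2), of v]
      by (intro exI[of _ "insert v P"]) fastforce
  qed
  then have "\<forall>v \<in> C. \<exists>P. r \<in> P \<and> v \<in> P \<and> P \<subseteq> C \<and> conn E P \<and> inj_on d P" by meson
  then obtain P where P: "\<And>v. v \<in> C \<Longrightarrow> r \<in> P v" "\<And>v. v \<in> C \<Longrightarrow> v \<in> P v"
    "\<And>v. v \<in> C \<Longrightarrow> P v \<subseteq> C" "\<And>v. v \<in> C \<Longrightarrow> conn E (P v)" "\<And>v. v \<in> C \<Longrightarrow> inj_on d (P v)"
    by metis
  let ?H = "\<Union>(P ` T)"
  have "finite T" using assms finite_subset by blast
  show ?thesis
  proof (intro exI[of _ ?H] exI[of _ d] conjI allI impI)
    show "T \<subseteq> ?H" "?H \<subseteq> C" using P(2,3)[OF subsetD[OF assms(4)]] by blast+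
    show "conn E ?H"
    proof (rule conn_Union_common[OF assms(1), of _ r])
      fix A assume "A \<in> P ` T"
      then obtain v where "v \<in> C" "A = P v" using assms(4) by blast
      then show "conn E A" "r \<in> A" using P(1,4) by simp_all
    qed
    show "d y \<le> Suc (d x)" if "(x, y) \<in> ?R" for x y using step that .
    show "card {x \<in> ?H. d x = m} \<le> card T" for m
    proof -
      have "card {x \<in> P v. d x = m} \<le> 1" if "v \<in> T" for v
      proof -
        have "v \<in> C" using that assms(4) by blast
        then have "finite (P v)" using finite_subset[OF P(3) assms(3)] by blast
        then have fin: "finite {x \<in> P v. d x = m}" by simp
        have "x = y" if "x \<in> {x \<in> P v. d x = m}" "y \<in> {x \<in> P v. d x = m}" for x y
          using that inj_onD[OF P(5)[OF \<open>v \<in> C\<close>]] by simp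
        then show ?thesis
          unfolding One_nat_def card_le_Suc0_iff_eq[OF fin] by blast
      qed
      moreover have "{x \<in> ?H. d x = m} = (\<Union>v \<in> T. {x \<in> P v. d x = m})" by blast
      ultimately show ?thesis
        using card_UN_le[OF \<open>finite T\<close>, of "\<lambda>v. {x \<in> P v. d x = m}"]
          sum_bounded_above[of T "\<lambda>v. card {x \<in> P v. d x = m}" 1] by simp
    qed
  qed
qed

section \<open>Complete minors from pairwise adjacent connected sets\<close>

lemma (in pair_graph) sym_parcs: "sym (parcs G)"
  using pair_sym_arcs by (simp add: symmetric_def)

text \<open>
  Branch sets are encoded as the fibres of a labelling \<open>m\<close>, because \<open>m\<close> stays unchanged when an
  edge inside a fibre is contracted.
\<close>

lemma contract_fibres:
  fixes m :: "'a \<Rightarrow> 'b"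
  assumes "pair_graph G"
    and "\<And>i. conn (parcs G) {v \<in> pverts G. m v = i}"
    and "\<And>i j. i \<in> m ` pverts G \<Longrightarrow> j \<in> m ` pverts G \<Longrightarrow> i \<noteq> j \<Longrightarrow>
      \<exists>x y. (x, y) \<in> parcs G \<and> m x = i \<and> m y = j"
  shows "\<exists>G'. edge_contraction\<^sup>*\<^sup>* G G' \<and> pair_graph G' \<and> inj_on m (pverts G') \<and>
    m ` pverts G' = m ` pverts G \<and> parcs G' = {(x, y). x \<in> pverts G' \<and> y \<in> pverts G' \<and> x \<noteq> y}"
  using assms
proof (induction "card (pverts G)" arbitrary: G rule: less_induct)
  case less
  interpret pair_graph G by fact
  show ?case
  proof (cases "inj_on m (pverts G)")
    case inj: True
    have "(x, y) \<in> parcs G" if xy: "x \<in> pverts G" "y \<in> pverts G" "x \<noteq> y" for x y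
    proof -
      have "m x \<noteq> m y" using inj xy by (auto dest: inj_onD)
      then obtain x' y' where e: "(x', y') \<in> parcs G" "m x' = m x" "m y' = m y"
        using less.prems(3)[of "m x" "m y"] xy by blast
      then have "x' = x" "y' = y"
        using inj_onD[OF inj] xy in_arcsD1[OF e(1)] in_arcsD2[OF e(1)] by simp_all
      then show ?thesis using e by simp
    qed
    then have "parcs G = {(x, y). x \<in> pverts G \<and> y \<in> pverts G \<and> x \<noteq> y}"
      using in_arcsD1 in_arcsD2 no_loops' by blast
    then show ?thesis using less.prems(1) inj by blast
  next
    case False
    then obtain x y where xy: "x \<in> pverts G" "y \<in> pverts G" "m x = m y" "x \<noteq> y"
      by (auto simp: inj_on_def)
    \<comment> \<open>The fibre of \<open>x\<close> is connected and has a second vertex, so some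
      edge inside it leaves \<open>{x}\<close>; this edge is contracted.\<close>
    obtain u v where "u \<in> {x}" "v \<in> {w \<in> pverts G. m w = m x}" "v \<notin> {x}" "(u, v) \<in> parcs G"
      by (rule conn_exit[OF less.prems(2)[of "m x"], of x "{x}" y]) (use xy in auto)
    then have v: "v \<in> pverts G" "m v = m x" "v \<noteq> x" "(x, v) \<in> parcs G" by auto
    let ?G = "contract_edge G x v"
    let ?p = "id(v := x)"
    have mp: "m (?p w) = m w" for w using v by simp
    have arc: "(?p a, ?p b) \<in> parcs ?G" if "(a, b) \<in> parcs G" "?p a \<noteq> ?p b" for a b
      using that image_eqI[of "(?p a, ?p b)" "map_prod ?p ?p" "(a, b)" "parcs G"]
      by (simp add: contract_edge_def)
    have verts: "pverts ?G = pverts G - {v}" by (simp add: contract_edge_def)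
    have img: "m ` pverts ?G = m ` pverts G"
    proof -
      have "m v \<in> m ` (pverts G - {v})" using xy(1) v by (metis DiffI imageI singletonD)
      then have "m ` insert v (pverts G - {v}) = m ` (pverts G - {v})" by auto
      then show ?thesis using v(1) by (simp add: verts insert_absorb)
    qed
    have "pair_graph ?G" by (rule pair_graph_contract_edge[OF less.prems(1) v(4)])
    moreover have "card (pverts ?G) < card (pverts G)"
      unfolding verts using v(1) by (intro psubset_card_mono pair_finite_verts) blast
    moreover have "conn (parcs ?G) {w \<in> pverts ?G. m w = i}" for i
      unfolding conn_def
    proof (intro ballI)
      fix a b assume ab: "a \<in> {w \<in> pverts ?G. m w = i}" "b \<in> {w \<in> pverts ?G. m w = i}"
      let ?R = "Restr (parcs ?G) {w \<in> pverts ?G. m w = i}"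
      have "(a, b) \<in> (Restr (parcs G) {w \<in> pverts G. m w = i})\<^sup>*"
        using less.prems(2)[of i] ab unfolding conn_def verts by blast
      \<comment> \<open>Project the walk along \<open>?p\<close>: the contracted edge becomes a
        stationary step, and every other arc survives within the same fibre.\<close>
      then have "(?p a, ?p b) \<in> ?R\<^sup>*"
      proof induction
        case (step c d)
        show ?case
        proof (cases "?p c = ?p d")
          case False
          have "?p w \<in> pverts ?G" if "w \<in> pverts G" for w
            using that xy(1) v(3) by (auto simp: verts)
          then have "(?p c, ?p d) \<in> ?R" using step(2) arc[OF _ False] mp by auto
          with step.IH show ?thesis by (rule rtrancl_into_rtrancl)
        qed (use step.IH in metis)
      qed simp
      moreover have "?p a = a" "?p b = b" using ab verts by auto
      ultimately show "(a, b) \<in> ?R\<^sup>*" by simp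
    qed
    moreover have "\<exists>a b. (a, b) \<in> parcs ?G \<and> m a = i \<and> m b = j"
      if ij: "i \<in> m ` pverts ?G" "j \<in> m ` pverts ?G" "i \<noteq> j" for i j
    proof -
      obtain a b where "(a, b) \<in> parcs G" "m a = i" "m b = j"
        using less.prems(3)[of i j] ij img by blast
      then show ?thesis using arc[of a b] mp ij(3) by metis
    qed
    ultimately obtain G' where G': "edge_contraction\<^sup>*\<^sup>* ?G G'" "pair_graph G'" "inj_on m (pverts G')"
      "m ` pverts G' = m ` pverts G" "parcs G' = {(x, y). x \<in> pverts G' \<and> y \<in> pverts G' \<and> x \<noteq> y}"
      using less.hyps[of ?G] img by auto
    have "edge_contraction G ?G" using v(4) by (auto simp: edge_contraction_def)
    then have "edge_contraction\<^sup>*\<^sup>* G G'" using G'(1) by (rule converse_rtranclp_into_rtranclp)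
    then show ?thesis using G'(2-) by blast
  qed
qed

text \<open>Delete everything outside the branch sets and contract each of them to a vertex with
  \<open>contract_fibres\<close>. Numbering the sets by \<open>{0..<n}\<close> makes the labelling
  an isomorphism onto the complete graph on these numbers.\<close>

lemma complete_minorI:
  assumes "pair_graph G" and "finite F" "card F = n"
    and F: "\<And>A. A \<in> F \<Longrightarrow> A \<noteq> {} \<and> A \<subseteq> pverts G \<and> conn (parcs G) A"
    and "disjoint F" and adj: "pairwise (adj (parcs G)) F"
  shows "\<exists>H :: nat pair_pre_digraph. K\<^bsub>n\<^esub> (with_proj H) \<and> is_minor H G"
proof -
  interpret pair_graph G by fact
  obtain g where g: "bij_betw g F {0..<n}"
    using ex_bij_betw_finite_nat[OF assms(2)] assms(3) by blast
  \<comment> \<open>Disjointness makes the branch set of \<open>v\<close> unique. Values off the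
    union of \<open>F\<close> are unspecified, but such vertices are not in
    \<open>?S\<close>.\<close>
  define m where "m v = g (THE A. A \<in> F \<and> v \<in> A)" for v
  have m: "m v = g A" if "A \<in> F" "v \<in> A" for v A
  proof -
    have "(THE A. A \<in> F \<and> v \<in> A) = A"
      using that disjointD[OF assms(5)] by (intro the_equality) blast+
    then show ?thesis by (simp add: m_def)
  qed
  let ?U = "\<Union>F"
  let ?S = "\<lparr>pverts = ?U, parcs = Restr (parcs G) ?U\<rparr>"
  have U: "?U \<subseteq> pverts G" using F by blast
  have S: "pair_graph ?S"
  proof
    show "finite (pverts ?S)" using finite_subset[OF U] by simp
    show "symmetric (with_proj ?S)"
      using sym_parcs by (auto simp: symmetric_def sym_def)
  qed (use no_loops' in auto)
  have fibre: "{v \<in> ?U. m v = g A} = A" if "A \<in> F" for A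
    using m that g by (auto simp: bij_betw_def inj_on_def)
  have img: "m ` ?U = {0..<n}"
  proof -
    have "m ` ?U = g ` F" using m F by (force simp: image_iff)
    then show ?thesis using g by (simp add: bij_betw_def)
  qed
  have "conn (parcs ?S) {v \<in> pverts ?S. m v = i}" for i
  proof (cases "i \<in> g ` F")
    case True
    then obtain A where A: "A \<in> F" "i = g A" by blast
    then have "Restr (Restr (parcs G) ?U) A = Restr (parcs G) A" by blast
    then show ?thesis using F[OF A(1)] fibre[OF A(1)] A(2) by (simp add: conn_def)
  next
    case False
    then have "{v \<in> pverts ?S. m v = i} = {}" using m by auto
    then show ?thesis unfolding conn_def by blast
  qed
  moreover have "\<exists>x y. (x, y) \<in> parcs ?S \<and> m x = i \<and> m y = j"
    if ij: "i \<in> m ` pverts ?S" "j \<in> m ` pverts ?S" "i \<noteq> j" for i j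
  proof -
    obtain A B where AB: "A \<in> F" "B \<in> F" "i = g A" "j = g B" using ij m by auto
    then have "adj (parcs G) A B" using adj ij(3) by (auto simp: pairwise_def)
    then obtain x y where "x \<in> A" "y \<in> B" "(x, y) \<in> parcs G" by (auto simp: adj_def)
    then show ?thesis using AB m by (intro exI[of _ x] exI[of _ y]) auto
  qed
  ultimately obtain G' where G': "edge_contraction\<^sup>*\<^sup>* ?S G'" "pair_graph G'" "inj_on m (pverts G')"
      "m ` pverts G' = {0..<n}" "parcs G' = {(x, y). x \<in> pverts G' \<and> y \<in> pverts G' \<and> x \<noteq> y}"
    using contract_fibres[OF S, of m] img by auto
  interpret G': pair_graph G' by fact
  let ?H = "\<lparr>pverts = {0..<n}, parcs = {(i, j). i \<in> {0..<n} \<and> j \<in> {0..<n} \<and> i \<noteq> j}\<rparr>"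
  have "K\<^bsub>n\<^esub> (with_proj ?H)" by (auto simp: complete_digraph_pair_def)
  moreover have "is_minor ?H G"
    unfolding is_minor_def
  proof (intro exI conjI)
    show "pair_graph ?S" "edge_contraction\<^sup>*\<^sup>* ?S G'" by fact+
    interpret S: pair_graph ?S by fact
    show "subgraph (with_proj ?S) (with_proj G)"
      using U wf_digraph S.wf_digraph by (auto simp: subgraph_def)
    let ?f = "\<lparr>iso_verts = m, iso_arcs = map_prod m m, iso_head = snd, iso_tail = fst\<rparr>"
    have arcs: "map_prod m m ` parcs G' = parcs ?H"
    proof (intro equalityI subsetI)
      fix e assume "e \<in> map_prod m m ` parcs G'"
      then show "e \<in> parcs ?H"
        using G'(4) inj_onD[OF G'(3)] unfolding G'(5) by auto
    next
      fix e assume "e \<in> parcs ?H"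
      then obtain i j where ij: "e = (i, j)" "i \<in> m ` pverts G'" "j \<in> m ` pverts G'" "i \<noteq> j"
        unfolding G'(4) by auto
      then obtain x y where "x \<in> pverts G'" "y \<in> pverts G'" "i = m x" "j = m y" by blast
      then show "e \<in> map_prod m m ` parcs G'"
        unfolding G'(5) using ij by (intro rev_image_eqI[of "(x, y)"]) auto
    qed
    have "inj_on (map_prod m m) (parcs G')"
    proof (rule inj_onI)
      fix a b assume "a \<in> parcs G'" "b \<in> parcs G'" "map_prod m m a = map_prod m m b"
      then show "a = b"
        unfolding G'(5) using inj_onD[OF G'(3)] by (cases a; cases b) auto
    qed
    then have "G'.digraph_isomorphism ?f"
      using G'(3) G'.wf_digraph by (simp add: G'.digraph_isomorphism_def)
    moreover have "with_proj ?H = app_iso ?f (with_proj G')"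
      using G'(4) arcs by (simp add: app_iso_def with_proj_def)
    ultimately show "digraph_iso (with_proj G') (with_proj ?H)"
      unfolding digraph_iso_def by blast
  qed
  ultimately show ?thesis by blast
qed

section \<open>Clustered colouring along a chordal partition\<close>

text \<open>
  \<open>W\<close> is the set of vertices still to be coloured and \<open>Q\<close> the set of parts already removed, with
  part colours \<open>f\<close>. The last assumption is the chordality invariant.
\<close>

lemma clustered_coloring:
  fixes E :: "'a rel" and f :: "'a set \<Rightarrow> nat"
  assumes "sym E"
    and no_model: "\<And>F. finite F \<Longrightarrow> (\<And>A. A \<in> F \<Longrightarrow> A \<noteq> {} \<and> A \<subseteq> V \<and> conn E A) \<Longrightarrow>
      disjoint F \<Longrightarrow> pairwise (adj E) F \<Longrightarrow> card F \<le> t"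
    and "finite W" "W \<subseteq> V" "finite Q" "disjoint Q"
    and "\<And>A. A \<in> Q \<Longrightarrow> A \<subseteq> V - W \<and> conn E A"
    and "\<And>D A B. conn E D \<Longrightarrow> D \<subseteq> W \<Longrightarrow> A \<in> Q \<Longrightarrow> B \<in> Q \<Longrightarrow> A \<noteq> B \<Longrightarrow>
      adj E D A \<Longrightarrow> adj E D B \<Longrightarrow> adj E A B \<and> f A \<noteq> f B"
  shows "\<exists>c :: 'a \<Rightarrow> nat \<times> bool. (\<forall>v \<in> W. fst (c v) < t) \<and>
    (\<forall>v \<in> W. \<forall>A \<in> Q. adj E {v} A \<longrightarrow> fst (c v) \<noteq> f A) \<and>
    (\<forall>S k. S \<subseteq> W \<and> conn E S \<and> (\<forall>v \<in> S. c v = k) \<longrightarrow> card S \<le> t)"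
  using assms(3-)
proof (induction W arbitrary: Q f rule: finite_psubset_induct)
  case (psubset W)
  note WV = psubset.prems(1) and Qfin = psubset.prems(2) and Qdisj = psubset.prems(3)
    and Qconn = psubset.prems(4) and Qadj = psubset.prems(5)
  show ?case
  proof (cases "W = {}")
    case False
    then obtain r where r: "r \<in> W" by blast
    define C where "C = {v. (r, v) \<in> (Restr E W)\<^sup>*}"
    note C = conn_component[OF assms(1) r, folded C_def]
    define QC where "QC = {A \<in> Q. adj E C A}"
    have QC: "QC \<subseteq> Q" "finite QC" using Qfin by (auto simp: QC_def)
    have "C \<notin> QC" using C(1,2) Qconn QC(1) by blast
    \<comment> \<open>By the chordality invariant applied to \<open>C\<close>, the touching parts
      and \<open>C\<close> itself are pairwise adjacent branch sets. Hence
      \<open>card QC < t\<close>, which leaves a part colour \<open>h\<close> free.\<close>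
    have "card (insert C QC) \<le> t"
    proof (rule no_model)
      show "A \<noteq> {} \<and> A \<subseteq> V \<and> conn E A" if "A \<in> insert C QC" for A
        using that C(1-3) WV Qconn by (auto simp: QC_def adj_def)
      show "disjoint (insert C QC)"
      proof -
        have "disjnt C A \<and> disjnt A C" if "A \<in> QC" for A
          using that Qconn[of A] C(2) QC(1) unfolding disjnt_def by blast
        then show ?thesis
          using pairwise_subset[OF Qdisj QC(1)] by (simp add: pairwise_insert)
      qed
      show "pairwise (adj E) (insert C QC)"
        using Qadj[OF C(3,2)] adj_sym[OF assms(1)] by (auto simp: pairwise_def QC_def)
    qed (use QC in simp)
    then have card_QC: "card QC < t" using \<open>C \<notin> QC\<close> QC by simp
    have "card (f ` QC) < card {..<t}" using card_QC card_image_le[OF QC(2), of f] by simp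
    then obtain h where h: "h < t" "h \<notin> f ` QC"
      using card_mono[of "f ` QC" "{..<t}"] QC(2) by (metis finite_imageI lessThan_iff not_le subsetI)
    have "\<forall>A \<in> QC. \<exists>w \<in> C. adj E {w} A" by (auto simp: QC_def adj_def)
    then obtain w where w: "\<And>A. A \<in> QC \<Longrightarrow> w A \<in> C \<and> adj E {w A} A" by metis
    \<comment> \<open>One neighbour of each touching part. Adding \<open>r\<close> keeps
      \<open>T\<close> nonempty when \<open>QC\<close> is empty and makes progress certain, and
      \<open>card QC < t\<close> pays for it.\<close>
    define T where "T = insert r (w ` QC)"
    have "card T \<le> Suc (card (w ` QC))" unfolding T_def by (rule card_insert_le_m1) auto
    then have card_T: "card T \<le> t" using card_image_le[OF QC(2), of w] card_QC by linarith
    have finC: "finite C" using C(2) psubset.hyps finite_subset by blast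
    have T: "T \<subseteq> C" "T \<noteq> {}" using w C(1) by (auto simp: T_def)
    obtain H and d :: "'a \<Rightarrow> nat" where H: "T \<subseteq> H" "H \<subseteq> C" "conn E H"
      and d: "\<And>x y. (x, y) \<in> Restr E C \<Longrightarrow> d y \<le> Suc (d x)"
        "\<And>m. card {x \<in> H. d x = m} \<le> card T"
      using geodesic_union[OF assms(1) C(3) finC T] by blast
    have "r \<in> H" using H(1) by (simp add: T_def)
    have "H \<notin> Q" using \<open>r \<in> H\<close> r Qconn by blast
    have H_adj: "adj E H A" if "A \<in> QC" for A
      using w[OF that] that H(1) by (auto simp: T_def intro: adj_mono)
    \<comment> \<open>A connected set of remaining vertices that touches \<open>H\<close> lies in
      \<open>C\<close>, so every earlier part it touches also touches \<open>C\<close>. As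
      \<open>H\<close> is adjacent to all of \<open>QC\<close> and \<open>h\<close> avoids their
      colours, the invariant survives the removal of \<open>H\<close>.\<close>
    have QC_I: "A \<in> QC" if D: "conn E D" "D \<subseteq> W" "adj E D H" and A: "A \<in> Q" "adj E D A" for D A
    proof -
      have "conn E (D \<union> H)" using conn_Un_adj[OF assms(1) D(1) H(3) D(3)] .
      then have "D \<union> H \<subseteq> C" using C D(2) H(2) \<open>r \<in> H\<close> by (intro C(4)) blast+
      then show ?thesis using A adj_mono[of E D A C A] by (simp add: QC_def)
    qed
    let ?f = "f(H := h)"
    have "\<exists>c :: 'a \<Rightarrow> nat \<times> bool. (\<forall>v \<in> W - H. fst (c v) < t) \<and>
      (\<forall>v \<in> W - H. \<forall>A \<in> insert H Q. adj E {v} A \<longrightarrow> fst (c v) \<noteq> ?f A) \<and>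
      (\<forall>S k. S \<subseteq> W - H \<and> conn E S \<and> (\<forall>v \<in> S. c v = k) \<longrightarrow> card S \<le> t)"
    proof (rule psubset.IH)
      show "W - H \<subset> W" using \<open>r \<in> H\<close> r by blast
      show "W - H \<subseteq> V" using WV by blast
      show "finite (insert H Q)" using Qfin by simp
      show "disjoint (insert H Q)"
      proof -
        have "disjnt H A \<and> disjnt A H" if "A \<in> Q" for A
          using that Qconn[of A] C(2) H(2) unfolding disjnt_def by blast
        then show ?thesis using Qdisj by (simp add: pairwise_insert)
      qed
      show "A \<subseteq> V - (W - H) \<and> conn E A" if "A \<in> insert H Q" for A
        using that Qconn H C(2) WV by blast
      show "adj E A B \<and> ?f A \<noteq> ?f B"
        if D: "conn E D" "D \<subseteq> W - H" and AB: "A \<in> insert H Q" "B \<in> insert H Q" "A \<noteq> B"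
          "adj E D A" "adj E D B" for D A B
      proof -
        have D': "D \<subseteq> W" using D(2) by blast
        consider "A = H" "B \<in> Q" | "B = H" "A \<in> Q" | "A \<in> Q" "B \<in> Q" "A \<noteq> H" "B \<noteq> H"
          using AB \<open>H \<notin> Q\<close> by blast
        then show ?thesis
        proof cases
          case 1
          then have "B \<in> QC" using QC_I[OF D(1) D'] AB by blast
          then show ?thesis using 1 AB H_adj h(2) by auto
        next
          case 2
          then have "A \<in> QC" using QC_I[OF D(1) D'] AB by blast
          then show ?thesis using 2 AB H_adj h(2) adj_sym[OF assms(1)] by auto
        next
          case 3
          then show ?thesis using Qadj[OF D(1) D'] AB by simp
        qed
      qed
    qed
    then obtain c :: "'a \<Rightarrow> nat \<times> bool" where c: "\<forall>v \<in> W - H. fst (c v) < t"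
      "\<forall>v \<in> W - H. \<forall>A \<in> insert H Q. adj E {v} A \<longrightarrow> fst (c v) \<noteq> ?f A"
      "\<forall>S k. S \<subseteq> W - H \<and> conn E S \<and> (\<forall>v \<in> S. c v = k) \<longrightarrow> card S \<le> t"
      by blast
    \<comment> \<open>The second colour coordinate on \<open>H\<close> is the parity of the
      distance, which separates consecutive levels.\<close>
    define c' where "c' v = (if v \<in> H then (h, even (d v)) else c v)" for v
    have "fst (c' v) < t" if "v \<in> W" for v
      using that c(1) h(1) by (simp add: c'_def)
    moreover have "fst (c' v) \<noteq> f A" if v: "v \<in> W" "A \<in> Q" "adj E {v} A" for v A
    proof (cases "v \<in> H")
      case True
      then have "adj E C A" using adj_mono[OF v(3)] H(2) by blast
      then have "A \<in> QC" using v(2) by (simp add: QC_def)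
      then show ?thesis using h(2) True by (auto simp: c'_def)
    next
      case False
      moreover have "A \<noteq> H" using v(2) \<open>H \<notin> Q\<close> by blast
      ultimately show ?thesis using c(2)[rule_format, of v A] v by (auto simp: c'_def)
    qed
    moreover have "card S \<le> t" if S: "S \<subseteq> W" "conn E S" "\<forall>v \<in> S. c' v = k" for S k
    proof (cases "S \<inter> H = {}")
      case True
      then have "\<forall>v \<in> S. c v = k" using S(3) by (auto simp: c'_def split: if_splits)
      moreover have "S \<subseteq> W - H" using True S(1) by blast
      ultimately show ?thesis using c(3) S(2) by blast
    next
      case False
      then obtain x where x: "x \<in> S" "x \<in> H" by blast
      \<comment> \<open>A later vertex adjacent to \<open>H\<close> avoids the part colour
        \<open>h\<close>, so a monochromatic connected set that meets \<open>H\<close> cannot leave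
        it.\<close>
      have "S \<subseteq> H"
      proof (rule ccontr)
        assume "\<not> S \<subseteq> H"
        then obtain y where "y \<in> S" "y \<notin> H" by blast
        from conn_exit[OF S(2) x this] obtain u v
          where uv: "u \<in> S" "u \<in> H" "v \<in> S" "v \<notin> H" "(u, v) \<in> E" by metis
        then have "adj E {v} H" using assms(1) by (auto simp: adj_def dest: symD)
        then have "fst (c v) \<noteq> h" using c(2)[rule_format, of v H] uv S(1) by auto
        moreover have "c' u = c' v" using S(3) uv by simp
        then have "c v = (h, even (d u))" using uv by (simp add: c'_def)
        ultimately show False by simp
      qed
      \<comment> \<open>Along an edge distances differ by at most one, and equal parity rules out a
        difference of one; hence \<open>S\<close> lies in a single level of
        \<open>H\<close>.\<close>
      have "d y = d x" if "y \<in> S" for y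
      proof -
        have "(x, y) \<in> (Restr E S)\<^sup>*" using S(2) x that by (simp add: conn_def)
        then show ?thesis
        proof induction
          case (step y z)
          then have yz: "(y, z) \<in> E" "y \<in> S" "z \<in> S" by blast+
          then have "y \<in> C" "z \<in> C" using \<open>S \<subseteq> H\<close> H(2) by blast+
          then have "d z \<le> Suc (d y)" "d y \<le> Suc (d z)"
            using d(1) yz assms(1) by (auto dest: symD)
          moreover have "c' y = c' z" using S(3) yz by simp
          then have "even (d y) = even (d z)" using yz \<open>S \<subseteq> H\<close> by (auto simp: c'_def split: if_splits)
          ultimately have "d z = d y" by (metis even_Suc le_SucE le_antisym)
          then show ?case using step.IH by simp
        qed simp
      qed
      then have "S \<subseteq> {y \<in> H. d y = d x}" using \<open>S \<subseteq> H\<close> by blast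
      moreover have "finite {y \<in> H. d y = d x}" using H(2) finC finite_subset by fastforce
      ultimately show ?thesis using card_mono d(2)[of "d x"] card_T by (meson le_trans)
    qed
    ultimately show ?thesis by (intro exI[of _ c']) blast
  qed (auto simp: conn_def)
qed

section \<open>From clustered colourings to partitions of the vertex set\<close>

text \<open>Connectedness of \<open>C\<close> is strong connectedness of its symmetrisation.
  Symmetry of \<open>parcs G\<close> turns each arc of the symmetrisation into an arc of
  \<open>G\<close> between vertices of \<open>C\<close>, so walks carry over.\<close>

lemma conn_of_connected_subgraph:
  assumes "subgraph C (with_proj G \<restriction> X)" "connected C" "sym (parcs G)"
  shows "verts C \<subseteq> X" "conn (parcs G) (verts C)"
proof -
  show "verts C \<subseteq> X" using assms(1) by (simp add: subgraph_def)
  interpret C: wf_digraph C using assms(1) by (simp add: subgraph_def)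
  have ends: "tail C = fst" "head C = snd" "arcs C \<subseteq> parcs G"
    using assms(1) by (auto simp: subgraph_def compatible_def)
  have "parcs (mk_symmetric C) \<subseteq> Restr (parcs G) (verts C)"
  proof
    fix e assume "e \<in> parcs (mk_symmetric C)"
    then obtain a where a: "a \<in> arcs C" "e = a \<or> e = (snd a, fst a)"
      by (auto simp: parcs_mk_symmetric ends)
    then have "a \<in> parcs G" "fst a \<in> verts C" "snd a \<in> verts C"
      using ends C.tail_in_verts[OF a(1)] C.head_in_verts[OF a(1)] by auto
    then show "e \<in> Restr (parcs G) (verts C)"
      using a(2) assms(3) by (cases a) (auto dest: symD)
  qed
  then have sub: "(parcs (mk_symmetric C))\<^sup>* \<subseteq> (Restr (parcs G) (verts C))\<^sup>*"
    by (rule rtrancl_mono)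
  show "conn (parcs G) (verts C)"
    unfolding conn_def
  proof (intro ballI)
    fix u v assume "u \<in> verts C" "v \<in> verts C"
    then have "u \<rightarrow>\<^sup>*\<^bsub>mk_symmetric C\<^esub> v"
      using assms(2) by (simp add: connected_def strongly_connected_def)
    then have "(u, v) \<in> (parcs (mk_symmetric C))\<^sup>*"
      by (auto simp: reachable_def intro: rtrancl_on_rtranclI)
    then show "(u, v) \<in> (Restr (parcs G) (verts C))\<^sup>*" using sub by blast
  qed
qed

theorem theorem1p8:
  fixes t :: nat
  assumes "t > 0"
  shows "\<exists>N :: nat. \<forall>G :: 'a pair_pre_digraph.
    pair_graph G \<and>
    \<not> (\<exists>H :: nat pair_pre_digraph. K\<^bsub>t + 1\<^esub> (with_proj H) \<and> is_minor H G) \<longrightarrow>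
    (\<exists>X :: nat \<Rightarrow> 'a set.
      (\<Union>i \<in> {1..3 * t}. X i) = pverts G \<and> disjoint_family_on X {1..3 * t} \<and>
      (\<forall>i \<in> {1..3 * t}. \<forall>C. connected_component_of_graph C (with_proj G \<restriction> X i) \<longrightarrow>
        card (verts C) \<le> N))"
proof (intro exI[of _ t] allI impI, elim conjE)
  fix G :: "'a pair_pre_digraph"
  assume G: "pair_graph G"
    and no_minor: "\<not> (\<exists>H :: nat pair_pre_digraph. K\<^bsub>t + 1\<^esub> (with_proj H) \<and> is_minor H G)"
  interpret pair_graph G by fact
  \<comment> \<open>Start with all vertices uncoloured and no part removed: the invariant is
    vacuous, and \<open>undefined\<close> serves as the colouring of no parts.\<close>
  have "\<exists>c :: 'a \<Rightarrow> nat \<times> bool. (\<forall>v \<in> pverts G. fst (c v) < t) \<and>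
    (\<forall>v \<in> pverts G. \<forall>A \<in> {}. adj (parcs G) {v} A \<longrightarrow> fst (c v) \<noteq> undefined A) \<and>
    (\<forall>S k. S \<subseteq> pverts G \<and> conn (parcs G) S \<and> (\<forall>v \<in> S. c v = k) \<longrightarrow> card S \<le> t)"
  proof (rule clustered_coloring[OF sym_parcs, of "pverts G"])
    fix F :: "'a set set"
    assume F: "finite F" "\<And>A. A \<in> F \<Longrightarrow> A \<noteq> {} \<and> A \<subseteq> pverts G \<and> conn (parcs G) A"
      "disjoint F" "pairwise (adj (parcs G)) F"
    show "card F \<le> t"
    proof (rule ccontr)
      assume "\<not> card F \<le> t"
      then obtain F' where F': "F' \<subseteq> F" "card F' = t + 1" "finite F'"
        using obtain_subset_with_card_n[of "t + 1" F] by (metis Suc_eq_plus1 not_less_eq_eq)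
      have "\<exists>H :: nat pair_pre_digraph. K\<^bsub>t + 1\<^esub> (with_proj H) \<and> is_minor H G"
        using F'(1) F pairwise_subset[OF _ F'(1)]
        by (intro complete_minorI[OF G F'(3,2)]) auto
      then show False using no_minor by blast
    qed
  qed (simp_all add: finite_verts[simplified])
  then obtain c :: "'a \<Rightarrow> nat \<times> bool" where c: "\<And>v. v \<in> pverts G \<Longrightarrow> fst (c v) < t"
    "\<And>S k. S \<subseteq> pverts G \<Longrightarrow> conn (parcs G) S \<Longrightarrow> \<forall>v \<in> S. c v = k \<Longrightarrow> card S \<le> t"
    by metis
  \<comment> \<open>Numbers the \<open>2 * t\<close> colours from 1: part colour \<open>k\<close>
    receives \<open>2 * k + 1\<close> and \<open>2 * k + 2\<close>. The classes with index above
    \<open>2 * t\<close> are empty.\<close>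
  define e :: "nat \<times> bool \<Rightarrow> nat" where "e p = 2 * fst p + (if snd p then 1 else 2)" for p
  have "p = q" if "e p = e q" for p q
    using that by (cases p; cases q) (auto simp: e_def split: if_splits; presburger)
  then have e_inj: "inj e" by (rule injI)
  define X where "X i = {v \<in> pverts G. e (c v) = i}" for i
  show "\<exists>X. (\<Union>i \<in> {1..3 * t}. X i) = pverts G \<and> disjoint_family_on X {1..3 * t} \<and>
    (\<forall>i \<in> {1..3 * t}. \<forall>C. connected_component_of_graph C (with_proj G \<restriction> X i) \<longrightarrow>
      card (verts C) \<le> t)"
  proof (intro exI[of _ X] conjI ballI allI impI)
    have "e (c v) \<in> {1..3 * t}" if "v \<in> pverts G" for v
      using c(1)[OF that] by (auto simp: e_def)
    then show "(\<Union>i \<in> {1..3 * t}. X i) = pverts G" by (auto simp: X_def)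
    show "disjoint_family_on X {1..3 * t}" by (auto simp: disjoint_family_on_def X_def)
    fix i C assume "connected_component_of_graph C (with_proj G \<restriction> X i)"
    then have "subgraph C (with_proj G \<restriction> X i)" "connected C"
      by (simp_all add: connected_component_of_graph_def pre_digraph.max_subgraph_def)
    note C = conn_of_connected_subgraph[OF this sym_parcs]
    \<comment> \<open>Injectivity of \<open>e\<close> makes each class \<open>X i\<close>
      monochromatic, so the bound on monochromatic connected sets applies to
      \<open>C\<close>.\<close>
    have "c v = inv e i" if "v \<in> verts C" for v
      using that C(1) inv_f_f[OF e_inj, of "c v"] by (auto simp: X_def)
    moreover have "verts C \<subseteq> pverts G" using C(1) by (auto simp: X_def)
    ultimately show "card (verts C) \<le> t" using c(2)[OF _ C(2)] by blast
  qed
qed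

end
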